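(* Let $m,n$ be positive integers. For every matrix $(a_{ij})\in\mathbb{R}^{m\times n}$ there exists a unique polynomial $p\in\mathcal{P}_m^n$ such that $p(i,j)=a_{ij}$ for all $(i,j)\in\{1,\ldots,m\}\times\{1,\ldots,n\}$.
   Context: $\mathcal{P}_m^n$ denotes the tensor product space $\Pi_{m-1}\otimes\Pi_{n-1}$ of bivariate real polynomials, i.e. the set of all polynomials of the form $p(x,y)=\sum_{k_1=0}^{m-1}\sum_{k_2=0}^{n-1}\lambda_{k_1,k_2}x^{k_1}y^{k_2}$ with $\lambda_{k_1,k_2}\in\mathbb{R}$. *)

theory Defs
  imports "HOL-Computational_Algebra.Polynomial"
begin

text \<open>
  Bivariate polynomials are elements of \<open>real poly poly\<close>, the outer variable being \<open>y\<close> and the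
  coefficients being polynomials in \<open>x\<close>; thus \<open>monom (monom c k1) k2\<close> is the term
  \<open>c * x ^ k1 * y ^ k2\<close>.
\<close>

definition bipoly_space :: "nat \<Rightarrow> nat \<Rightarrow> real poly poly set" where
  "bipoly_space m n =
     {p. \<exists>c :: nat \<Rightarrow> nat \<Rightarrow> real. p = (\<Sum>k1<m. \<Sum>k2<n. monom (monom (c k1 k2) k1) k2)}"

text \<open>The constant polynomial \<open>[:y:]\<close> is substituted for the outer variable, then \<open>x\<close> for the inner.\<close>

definition bieval :: "real poly poly \<Rightarrow> real \<Rightarrow> real \<Rightarrow> real" where
  "bieval p x y = poly (poly p [:y:]) x"

lemma bieval_monom: "bieval (monom (monom c k1) k2) x y = c * x ^ k1 * y ^ k2"
  by (simp add: bieval_def poly_monom)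

lemma bieval_sum:
  "bieval (\<Sum>k1<m. \<Sum>k2<n. monom (monom (c k1 k2) k1) k2) x y
     = (\<Sum>k1<m. \<Sum>k2<n. c k1 k2 * x ^ k1 * y ^ k2)"
  by (simp add: bieval_def poly_sum poly_monom)

end

theory Submission
  imports Defs
begin

text \<open>
  Tensor products of univariate Lagrange polynomials solve the interpolation problem; for
  uniqueness, a univariate polynomial with as many zeros as coefficients vanishes, which is applied
  first in \<open>x\<close> for each fixed node \<open>y = j\<close> and then in \<open>y\<close> for each power of \<open>x\<close>.
\<close>

text \<open>The product over \<open>u\<close> in \<open>S - {s}\<close> of (t - u) / (s - u) has the
  required values, and its coefficients serve as \<open>c\<close>. Its values are written as
  coefficient sums because products of such coefficients are what the bivariate interpolant is built
  from.\<close>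

lemma lagrange_basis_exists:
  fixes S :: "'a :: field set"
  assumes "finite S" "s \<in> S"
  obtains c :: "nat \<Rightarrow> 'a"
    where "\<And>t. t \<in> S \<Longrightarrow> (\<Sum>k<card S. c k * t ^ k) = (if t = s then 1 else 0)"
proof -
  define L where "L = (\<Prod>u\<in>S - {s}. smult (inverse (s - u)) [:- u, 1:])"
  have "degree L \<le> (\<Sum>u\<in>S - {s}. degree (smult (inverse (s - u)) [:- u, 1:]))"
    unfolding L_def by (rule degree_prod_sum_le[unfolded o_def]) (use assms in auto)
  also have "\<dots> \<le> (\<Sum>u\<in>S - {s}. 1)"
    by (intro sum_mono) simp
  \<comment> \<open>There is one linear factor per node other than \<open>s\<close>; since
    \<open>s\<close> lies in the finite set \<open>S\<close>, removing it makes the bound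
    strict.\<close>
  also have "\<dots> < card S"
    using card_Diff1_less[OF assms] by simp
  finally have deg: "degree L < card S" .
  have eval: "poly L t = (if t = s then 1 else 0)" if "t \<in> S" for t
  proof (cases "t = s")
    case True
    have "poly (smult (inverse (s - u)) [:- u, 1:]) s = 1" if "u \<noteq> s" for u
      using that by (simp add: divide_simps)
    with True show ?thesis
      by (auto simp del: poly_smult simp: L_def poly_prod intro!: prod.neutral)
  next
    case False
    then show ?thesis
      using assms that by (auto simp: L_def poly_prod)
  qed
  have "(\<Sum>k<card S. coeff L k * t ^ k) = poly L t" for t
    unfolding poly_altdef using deg
    by (intro sum.mono_neutral_right) (auto simp: coeff_eq_0)
  with eval show ?thesis
    by (intro that[of "coeff L"]) simp
qed

text \<open>A nonzero polynomial over an integral domain has at most as many roots as its degree,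
  which here is below \<open>card S\<close>.\<close>

lemma coeffs_zero_if_vanishes:
  fixes S :: "'a :: idom set"
  assumes "\<And>s. s \<in> S \<Longrightarrow> (\<Sum>k<card S. c k * s ^ k) = 0" and "k < card S"
  shows "c k = 0"
proof -
  define p where "p = (\<Sum>k<card S. monom (c k) k)"
  have coeff_p: "coeff p l = (if l < card S then c l else 0)" for l
    by (simp add: p_def coeff_sum)
  have "degree p \<le> card S - 1"
    by (intro degree_le) (auto simp: coeff_p)
  \<comment> \<open>Subtraction is truncated, so \<open>card S - 1\<close> is below
    \<open>card S\<close> only once \<open>k < card S\<close> makes \<open>card S\<close>
    positive.\<close>
  with \<open>k < card S\<close> have "degree p < card S"
    by linarith
  moreover have "poly p s = 0" if "s \<in> S" for s
    using assms(1)[OF that] by (simp add: p_def poly_sum poly_monom)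
  ultimately have "p = 0"
    using poly_eqI_degree[of S p 0] assms(2) by simp
  with coeff_p[of k] assms(2) show ?thesis
    by simp
qed

theorem theorem3p5:
  fixes m n :: nat and a :: "nat \<Rightarrow> nat \<Rightarrow> real"
  assumes "m \<ge> 1" and "n \<ge> 1"
  shows "\<exists>!p. p \<in> bipoly_space m n \<and>
           (\<forall>i\<in>{1..m}. \<forall>j\<in>{1..n}. bieval p (real i) (real j) = a i j)"
proof (rule ex_ex1I)
  have card_nodes: "card (real ` {1..N}) = N" for N :: nat
    by (simp add: card_image)
  have "\<exists>c. \<forall>t\<in>{1..N}. (\<Sum>k<N. c k * real t ^ k) = (if t = s then 1 else 0)"
    if "s \<in> {1..N}" for s N :: nat
  proof -
    have "finite (real ` {1..N})" "real s \<in> real ` {1..N}"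
      using that by auto
    then obtain c where "\<And>t. t \<in> real ` {1..N} \<Longrightarrow>
        (\<Sum>k<card (real ` {1..N}). c k * t ^ k) = (if t = real s then 1 else 0)"
      by (rule lagrange_basis_exists) blast
    then show ?thesis
      unfolding card_nodes by (intro exI[of _ c]) simp
  qed
  \<comment> \<open>Choice over the nodes \<open>s\<close>: \<open>L s k\<close> is the coefficient
    of t^k in the Lagrange polynomial of \<open>s\<close>.\<close>
  then have basis: "\<exists>L. \<forall>s\<in>{1..N}. \<forall>t\<in>{1..N}.
      (\<Sum>k<N. L s k * real t ^ k) = (if t = s then 1 else 0)" for N :: nat
    by (intro bchoice ballI)
  obtain A where A: "\<forall>s\<in>{1..m}. \<forall>t\<in>{1..m}.
      (\<Sum>k<m. A s k * real t ^ k) = (if t = s then 1 else 0)"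
    using basis by blast
  obtain B where B: "\<forall>s\<in>{1..n}. \<forall>t\<in>{1..n}.
      (\<Sum>k<n. B s k * real t ^ k) = (if t = s then 1 else 0)"
    using basis by blast
  \<comment> \<open>The coefficient of x^k1 y^k2 in the sum of a_ij A_i(x) B_j(y), where A_i and B_j
    are the Lagrange polynomials with coefficients \<open>A i\<close> and
    \<open>B j\<close>.\<close>
  define b where "b k1 k2 = (\<Sum>i=1..m. \<Sum>j=1..n. a i j * A i k1 * B j k2)" for k1 k2
  define f where "f = (\<Sum>k1<m. \<Sum>k2<n. monom (monom (b k1 k2) k1) k2)"
  have "bieval f (real s) (real t) = a s t" if st: "s \<in> {1..m}" "t \<in> {1..n}" for s t
  proof -
    have "bieval f (real s) (real t) = (\<Sum>k1<m. \<Sum>k2<n. \<Sum>i=1..m. \<Sum>j=1..n.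
        a i j * (A i k1 * real s ^ k1) * (B j k2 * real t ^ k2))"
      by (simp add: f_def bieval_sum b_def sum_distrib_left sum_distrib_right mult_ac)
    \<comment> \<open>The exchanges move \<open>i\<close> and \<open>j\<close> outward, so that the
      sums over \<open>k1\<close> and \<open>k2\<close> factor into A_i(s) times B_j(t).\<close>
    also have "\<dots> = (\<Sum>k1<m. \<Sum>i=1..m. \<Sum>k2<n. \<Sum>j=1..n.
        a i j * (A i k1 * real s ^ k1) * (B j k2 * real t ^ k2))"
      by (intro sum.cong refl sum.swap)
    also have "\<dots> = (\<Sum>i=1..m. \<Sum>k1<m. \<Sum>j=1..n. \<Sum>k2<n.
        a i j * (A i k1 * real s ^ k1) * (B j k2 * real t ^ k2))"
      by (subst sum.swap) (intro sum.cong refl sum.swap)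
    also have "\<dots> = (\<Sum>i=1..m. \<Sum>j=1..n. \<Sum>k1<m. \<Sum>k2<n.
        a i j * (A i k1 * real s ^ k1) * (B j k2 * real t ^ k2))"
      by (intro sum.cong refl sum.swap)
    also have "\<dots> = (\<Sum>i=1..m. \<Sum>j=1..n.
        a i j * (\<Sum>k<m. A i k * real s ^ k) * (\<Sum>k<n. B j k * real t ^ k))"
      by (simp only: sum_distrib_left [symmetric] sum_distrib_right [symmetric])
    also have "\<dots> = (\<Sum>i=1..m. \<Sum>j=1..n. if t = j then if s = i then a i j else 0 else 0)"
      using st by (intro sum.cong refl) (simp add: A B)
    also have "\<dots> = a s t"
      using st by simp
    finally show ?thesis .
  qed
  moreover have "f \<in> bipoly_space m n"
    unfolding bipoly_space_def f_def by blast
  ultimately show "\<exists>p. p \<in> bipoly_space m n \<and>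
      (\<forall>i\<in>{1..m}. \<forall>j\<in>{1..n}. bieval p (real i) (real j) = a i j)"
    by blast

  fix p q
  assume p: "p \<in> bipoly_space m n \<and>
      (\<forall>i\<in>{1..m}. \<forall>j\<in>{1..n}. bieval p (real i) (real j) = a i j)"
    and q: "q \<in> bipoly_space m n \<and>
      (\<forall>i\<in>{1..m}. \<forall>j\<in>{1..n}. bieval q (real i) (real j) = a i j)"
  obtain c where c: "p = (\<Sum>k1<m. \<Sum>k2<n. monom (monom (c k1 k2) k1) k2)"
    using p unfolding bipoly_space_def by blast
  obtain d where d: "q = (\<Sum>k1<m. \<Sum>k2<n. monom (monom (d k1 k2) k1) k2)"
    using q unfolding bipoly_space_def by blast
  \<comment> \<open>On the line y = j the difference of \<open>p\<close> and \<open>q\<close> is a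
    polynomial in x whose coefficient at x^k1 is this sum; it vanishes at the \<open>m\<close>
    nodes.\<close>
  have row: "(\<Sum>k2<n. (c k1 k2 - d k1 k2) * real j ^ k2) = 0"
    if "k1 < m" "j \<in> {1..n}" for k1 j
  proof (rule coeffs_zero_if_vanishes[of "real ` {1..m}"
        "\<lambda>k1. \<Sum>k2<n. (c k1 k2 - d k1 k2) * real j ^ k2", unfolded card_nodes])
    fix x
    assume "x \<in> real ` {1..m}"
    then have "bieval p x (real j) = bieval q x (real j)"
      using p q that by auto
    then show "(\<Sum>k1<m. (\<Sum>k2<n. (c k1 k2 - d k1 k2) * real j ^ k2) * x ^ k1) = 0"
      by (simp add: c d bieval_sum sum_distrib_left sum_subtractf algebra_simps)
  qed (use that in simp)
  have "c k1 k2 - d k1 k2 = 0" if "k1 < m" "k2 < n" for k1 k2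
    by (rule coeffs_zero_if_vanishes[of "real ` {1..n}" "\<lambda>k2. c k1 k2 - d k1 k2",
          unfolded card_nodes])
      (use row that in auto)
  \<comment> \<open>Agreement of \<open>c\<close> and \<open>d\<close> below \<open>m\<close> and
    \<open>n\<close> suffices, as the defining sums use no other values.\<close>
  then show "p = q"
    by (simp add: c d)
qed

end
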